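(* Assume that the splitting measure $\mathcal{W}$ satisfies: there exists $0<\delta<1$ with $\mathcal{W}([0,\delta])=1$, and $\int_0^1 \frac{|\log x|}{x}\,\mathcal{W}(dx)<+\infty$. Let $(A^\varepsilon)_{\varepsilon>0}$ be a family of integrable random variables with values in $\mathbb{N}=\{0,1,2,\ldots\}$ such that $$\lim_{\varepsilon\to 0}A^\varepsilon=0\ \text{ in distribution}\qquad\text{and}\qquad \limsup_{\varepsilon\to0}\mathbb{E}(A^\varepsilon\mid A^\varepsilon>0)<+\infty .$$ Then there exist $\varepsilon_0>0$ and a finite constant $C^1_{\mathcal{W}}$ such that for every $0<\varepsilon\le\varepsilon_0$ and every $n\ge 0$ the variable $R_n^{A^\varepsilon}$ is integrable, and $$\mathbb{E}(R_n^{A^\varepsilon})\le n\,C^1_{\mathcal{W}},\qquad \forall n\ge 1 .$$ In particular, for such an $\varepsilon$, the Poisson transform $x\mapsto\sum_{n\ge0}\mathbb{E}(R_n^{A^\varepsilon})\frac{x^n}{n!}e^{-x}$ of the sequence $(\mathbb{E}(R_n^{A^\varepsilon}))$ is defined and differentiable on $\mathbb{R}$.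
   Context: Tree algorithm with arrivals. Fix an integer $D\ge 2$. The branching mechanism is given by a random integer $G\ge2$ and, for each $\ell\ge2$, a random probability vector $V_\ell=(V_{1,\ell},\ldots,V_{\ell,\ell})$ on $\{1,\ldots,\ell\}$ (the weights used when $G=\ell$). The arrivals are described by a random variable $A$ with values in $\mathbb{N}$. The algorithm starts with $n$ items at a root node. A node containing $n<D$ items is a leaf: the algorithm stops there. A node containing $n\ge D$ items is split: a fresh copy of $G$ is drawn; conditionally on $G=\ell$ and on the vector $V_\ell$, the $n$ items are distributed independently among $\ell$ children, each item going to child $i$ with probability $V_{i,\ell}$, so that the vector $(n_1,\ldots,n_\ell)$ of numbers of items is multinomial with parameters $n$ and $(V_{1,\ell},\ldots,V_{\ell,\ell})$; then child $i$ receives $A_i$ additional new items, where $A_1,\ldots,A_\ell$ are independent with the distribution of $A$, independent of everything else. The algorithm is applied recursively and independently to each child $i$, which starts with $n_i+A_i$ items. $R_n^A\in\{1,2,\ldots\}\cup\{+\infty\}$ denotes the total number of nodes of the resulting tree (root and leaves included) when there are $n$ items at the root; in particular $R_n^A=1$ for $0\le n<D$. The splitting measure $\mathcal{W}$ is the probability distribution on $[0,1]$ defined by $$\int f(x)\,\mathcal{W}(dx)=\mathbb{E}\Big(\sum_{i=1}^G V_{i,G}f(V_{i,G})\Big)=\sum_{\ell\ge2}\sum_{i=1}^\ell\mathbb{P}(G=\ell)\,\mathbb{E}(V_{i,\ell}f(V_{i,\ell}))$$ for nonnegative Borel functions $f$. In the theorem, the branching mechanism and $D$ are fixed and $A$ is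 taken to be $A^\varepsilon$.
   Formalization: Adds that the expected number of children with weight exactly 0 is finite; without it the claim fails, e.g. G of infinite mean and V_l=(1/2,1/2,0,...,0), where W is the Dirac mass at 1/2 but R_n>=1+G is not integrable for n>=D. *)

theory Defs
  imports "HOL-Probability.Probability"
begin

section \<open>Branching mechanism and splitting measure\<close>

text \<open>
  Only the joint law of \<open>G\<close> and each single vector \<open>V\<^sub>l = (V 1 l, \<dots>, V l l)\<close> matters. The
  independence of \<open>G\<close> and \<open>V\<^sub>l\<close> says that, given \<open>G = l\<close>, the weights have the law of \<open>V\<^sub>l\<close>.
\<close>

locale branching_mechanism = prob_space M
  for M :: "'a measure" +
  fixes G :: "'a \<Rightarrow> nat" and V :: "nat \<Rightarrow> nat \<Rightarrow> 'a \<Rightarrow> real"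
  assumes G_measurable [measurable]: "G \<in> M \<rightarrow>\<^sub>M count_space UNIV"
    and G_ge_2: "\<And>w. w \<in> space M \<Longrightarrow> 2 \<le> G w"
    and V_measurable: "\<And>l i. 2 \<le> l \<Longrightarrow> i \<in> {1..l} \<Longrightarrow> V i l \<in> borel_measurable M"
    and V_nonneg: "\<And>l i w. 2 \<le> l \<Longrightarrow> i \<in> {1..l} \<Longrightarrow> w \<in> space M \<Longrightarrow> 0 \<le> V i l w"
    and V_sum: "\<And>l w. 2 \<le> l \<Longrightarrow> w \<in> space M \<Longrightarrow> (\<Sum>i=1..l. V i l w) = 1"
    and G_V_indep: "\<And>l. 2 \<le> l \<Longrightarrow>
      indep_set (sets (vimage_algebra (space M) G (count_space UNIV)))
        (sets (vimage_algebra (space M) (\<lambda>w. \<lambda>i\<in>{1..l}. V i l w) (\<Pi>\<^sub>M i\<in>{1..l}. borel)))"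

text \<open>
  The size-biased law of the weights. Children of weight \<open>0\<close> leave no trace in it, although they are
  nodes of the tree.
\<close>

definition splitting_measure ::
    "'a measure \<Rightarrow> ('a \<Rightarrow> nat) \<Rightarrow> (nat \<Rightarrow> nat \<Rightarrow> 'a \<Rightarrow> real) \<Rightarrow> real measure" where
  "splitting_measure M G V = measure_of UNIV (sets borel)
     (\<lambda>B. \<integral>\<^sup>+w. (\<Sum>i=1..G w. ennreal (V i (G w) w) * indicator B (V i (G w) w)) \<partial>M)"


section \<open>One splitting step\<close>

definition weight_pmf :: "nat \<Rightarrow> (nat \<Rightarrow> real) \<Rightarrow> nat pmf" where
  "weight_pmf l v = embed_pmf (\<lambda>i. if i \<in> {1..l} then v i else 0)"

text \<open>
  \<open>c k\<close> is the child chosen by item \<open>k\<close> and \<open>a i\<close> the number of new items at child \<open>i\<close>; the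
  result lists the numbers of items of the children \<open>1, \<dots>, l\<close>.
\<close>

definition split_pmf :: "nat pmf \<Rightarrow> nat \<Rightarrow> nat \<Rightarrow> (nat \<Rightarrow> real) \<Rightarrow> nat list pmf" where
  "split_pmf A n l v = do {
     c \<leftarrow> Pi_pmf {..<n} 0 (\<lambda>_. weight_pmf l v);
     a \<leftarrow> Pi_pmf {1..l} 0 (\<lambda>_. A);
     return_pmf (map (\<lambda>i. card {k\<in>{..<n}. c k = i} + a i) [1..<Suc l])
   }"

definition split_law ::
    "'a measure \<Rightarrow> ('a \<Rightarrow> nat) \<Rightarrow> (nat \<Rightarrow> nat \<Rightarrow> 'a \<Rightarrow> real) \<Rightarrow> nat pmf \<Rightarrow> nat \<Rightarrow> nat list measure" where
  "split_law M G V A n =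
     M \<bind> (\<lambda>w. measure_pmf (split_pmf A n (G w) (\<lambda>i. V i (G w) w)))"


section \<open>The tree and its number of nodes\<close>

text \<open>
  Nodes are addressed by the path from the root, most recent step first. The outcome \<open>s (u, m)\<close> is
  the list of item numbers of the children of \<open>u\<close> that is used if \<open>u\<close> contains \<open>m\<close> items. All these
  outcomes are independent, and at most one of the outcomes \<open>s (u, _)\<close> is used, with an index
  determined by the outcomes at the strict ancestors of \<open>u\<close>, so that the subtrees of the children
  of a node are independent given the numbers of items these children start with.
\<close>

definition tree_space ::
    "'a measure \<Rightarrow> ('a \<Rightarrow> nat) \<Rightarrow> (nat \<Rightarrow> nat \<Rightarrow> 'a \<Rightarrow> real) \<Rightarrow> nat pmf
      \<Rightarrow> (nat list \<times> nat \<Rightarrow> nat list) measure" where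
  "tree_space M G V A = (\<Pi>\<^sub>M (u, m)\<in>UNIV. split_law M G V A m)"

text \<open>Number of items at a node; \<open>None\<close> if the node does not belong to the tree.\<close>

primrec items ::
    "nat \<Rightarrow> nat \<Rightarrow> (nat list \<times> nat \<Rightarrow> nat list) \<Rightarrow> nat list \<Rightarrow> nat option" where
  "items D n s [] = Some n"
| "items D n s (i # u) =
     (case items D n s u of
        None \<Rightarrow> None
      | Some m \<Rightarrow> if D \<le> m \<and> i < length (s (u, m)) then Some (s (u, m) ! i) else None)"

definition num_nodes :: "nat \<Rightarrow> nat \<Rightarrow> (nat list \<times> nat \<Rightarrow> nat list) \<Rightarrow> ennreal" where
  "num_nodes D n s = emeasure (count_space UNIV) {u. items D n s u \<noteq> None}"

definition mean_nodes ::
    "'a measure \<Rightarrow> ('a \<Rightarrow> nat) \<Rightarrow> (nat \<Rightarrow> nat \<Rightarrow> 'a \<Rightarrow> real) \<Rightarrow> nat pmf \<Rightarrow> nat \<Rightarrow> nat \<Rightarrow> ennreal" where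
  "mean_nodes M G V A D n = (\<integral>\<^sup>+s. num_nodes D n s \<partial>tree_space M G V A)"

definition integrable_nodes ::
    "'a measure \<Rightarrow> ('a \<Rightarrow> nat) \<Rightarrow> (nat \<Rightarrow> nat \<Rightarrow> 'a \<Rightarrow> real) \<Rightarrow> nat pmf \<Rightarrow> nat \<Rightarrow> nat \<Rightarrow> bool" where
  "integrable_nodes M G V A D n \<longleftrightarrow>
     num_nodes D n \<in> borel_measurable (tree_space M G V A) \<and> mean_nodes M G V A D n < \<infinity>"


section \<open>Families of arrival laws, Poisson transform\<close>

text \<open>Convergence in distribution along a filter, as \<^const>\<open>weak_conv_m\<close> for sequences.\<close>

definition weak_conv_along :: "('b \<Rightarrow> real measure) \<Rightarrow> real measure \<Rightarrow> 'b filter \<Rightarrow> bool" where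
  "weak_conv_along P Q F \<longleftrightarrow>
     (\<forall>x. isCont (cdf Q) x \<longrightarrow> ((\<lambda>e. cdf (P e) x) \<longlongrightarrow> cdf Q x) F)"

text \<open>The conditional mean given positivity; it is \<open>0\<close> if the variable is a.s. zero.\<close>

definition mean_given_pos :: "nat pmf \<Rightarrow> real" where
  "mean_given_pos A =
     measure_pmf.expectation A (\<lambda>k. real k * indicator {0<..} k) / measure_pmf.prob A {0<..}"

definition poisson_term :: "(nat \<Rightarrow> real) \<Rightarrow> real \<Rightarrow> nat \<Rightarrow> real" where
  "poisson_term r x n = r n * (x ^ n / fact n) * exp (- x)"

definition poisson_transform :: "(nat \<Rightarrow> real) \<Rightarrow> real \<Rightarrow> real" where
  "poisson_transform r x = (\<Sum>n. poisson_term r x n)"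


section \<open>Well-definedness of the objects above\<close>

lemma weak_conv_along_sequentially: "weak_conv_along P Q sequentially \<longleftrightarrow> weak_conv_m P Q"
  by (simp add: weak_conv_along_def weak_conv_m_def weak_conv_def)

lemma pmf_weight_pmf:
  assumes "\<And>i. i \<in> {1..l} \<Longrightarrow> 0 \<le> v i" "(\<Sum>i=1..l. v i) = 1"
  shows "pmf (weight_pmf l v) i = (if i \<in> {1..l} then v i else 0)"
  unfolding weight_pmf_def
proof (rule pmf_embed_pmf)
  show "0 \<le> (if x \<in> {1..l} then v x else 0)" for x using assms(1) by simp
  have "(\<integral>\<^sup>+x. ennreal (if x \<in> {1..l} then v x else 0) \<partial>count_space UNIV)
      = (\<Sum>x=1..l. ennreal (if x \<in> {1..l} then v x else 0))"
    by (rule nn_integral_count_space') auto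
  also have "\<dots> = (\<Sum>x=1..l. ennreal (v x))"
    by (intro sum.cong) auto
  also have "\<dots> = ennreal (\<Sum>x=1..l. v x)"
    using assms(1) by (intro sum_ennreal) auto
  finally show "(\<integral>\<^sup>+x. ennreal (if x \<in> {1..l} then v x else 0) \<partial>count_space UNIV) = 1"
    using assms(2) by simp
qed

context branching_mechanism
begin

lemma measurable_G_cases:
  assumes "\<And>l. 2 \<le> l \<Longrightarrow> f l \<in> M \<rightarrow>\<^sub>M N"
  shows "(\<lambda>w. f (G w) w) \<in> M \<rightarrow>\<^sub>M N"
proof (rule measurable_compose_countable'[where I = "{2..}"])
  show "f l \<in> M \<rightarrow>\<^sub>M N" if "l \<in> {2..}" for l
    using that by (intro assms) simp
  have "G \<in> M \<rightarrow>\<^sub>M restrict_space (count_space UNIV) {2..}"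
    by (rule measurable_restrict_space2) (simp_all add: G_ge_2 Pi_iff)
  then show "G \<in> M \<rightarrow>\<^sub>M count_space {2..}"
    by (simp add: restrict_count_space)
qed simp

lemma borel_measurable_weight_sum:
  assumes [measurable]: "f \<in> borel_measurable borel"
  shows "(\<lambda>w. \<Sum>i=1..G w. ennreal (V i (G w) w) * f (V i (G w) w)) \<in> borel_measurable M"
proof (rule measurable_G_cases)
  fix l :: nat assume l: "2 \<le> l"
  have [measurable]: "i \<in> {1..l} \<Longrightarrow> V i l \<in> borel_measurable M" for i
    using V_measurable[OF l] .
  show "(\<lambda>w. \<Sum>i=1..l. ennreal (V i l w) * f (V i l w)) \<in> borel_measurable M"
    by measurable
qed

lemma sets_splitting_measure [simp, measurable_cong]: "sets (splitting_measure M G V) = sets borel"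
  and space_splitting_measure [simp]: "space (splitting_measure M G V) = UNIV"
  using sets.sets_measure_of_eq[of "borel :: real measure"]
    sets.space_measure_of_eq[of "borel :: real measure"]
  by (simp_all only: splitting_measure_def space_borel)

lemma emeasure_splitting_measure:
  assumes "B \<in> sets borel"
  shows "emeasure (splitting_measure M G V) B =
    (\<integral>\<^sup>+w. (\<Sum>i=1..G w. ennreal (V i (G w) w) * indicator B (V i (G w) w)) \<partial>M)"
  unfolding splitting_measure_def
proof (rule emeasure_measure_of_sigma)
  let ?m = "\<lambda>B. \<integral>\<^sup>+w. (\<Sum>i=1..G w. ennreal (V i (G w) w) * indicator B (V i (G w) w)) \<partial>M"
  show "sigma_algebra UNIV (sets (borel :: real measure))"
    using sets.sigma_algebra_axioms[of "borel :: real measure"] by simp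
  show "positive (sets borel) ?m" by (simp add: positive_def)
  show "countably_additive (sets borel) ?m"
  proof (rule countably_additiveI)
    fix F :: "nat \<Rightarrow> real set"
    assume F: "range F \<subseteq> sets borel" "disjoint_family F"
    have "(\<Sum>n. ?m (F n)) =
        (\<integral>\<^sup>+w. (\<Sum>n. \<Sum>i=1..G w. ennreal (V i (G w) w) * indicator (F n) (V i (G w) w)) \<partial>M)"
      using F by (intro nn_integral_suminf[symmetric] borel_measurable_weight_sum) auto
    also have "\<dots> = ?m (\<Union>n. F n)"
      by (intro nn_integral_cong)
        (simp only: suminf_sum[OF summableI] ennreal_suminf_cmult suminf_indicator[OF F(2)])
    finally show "(\<Sum>n. ?m (F n)) = ?m (\<Union>n. F n)" .
  qed
qed fact

lemma nn_integral_splitting_measure: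
  assumes "f \<in> borel_measurable borel"
  shows "(\<integral>\<^sup>+x. f x \<partial>splitting_measure M G V) =
    (\<integral>\<^sup>+w. (\<Sum>i=1..G w. ennreal (V i (G w) w) * f (V i (G w) w)) \<partial>M)"
proof -
  have "f \<in> borel_measurable (splitting_measure M G V)"
    using assms by simp
  then show ?thesis
  proof (induction f rule: borel_measurable_induct)
    case (cong f g)
    have "f = g" using cong(3) by auto
    with cong show ?case by simp
  next
    case (set B)
    then show ?case by (simp add: emeasure_splitting_measure)
  next
    case (mult u c)
    have [measurable]: "u \<in> borel_measurable borel" using mult by simp
    have "(\<Sum>i=1..G w. ennreal (V i (G w) w) * (c * u (V i (G w) w))) =
        c * (\<Sum>i=1..G w. ennreal (V i (G w) w) * u (V i (G w) w))" for w
      by (simp only: sum_distrib_left mult.left_commute)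
    moreover have "(\<integral>\<^sup>+x. c * u x \<partial>splitting_measure M G V) =
        c * (\<integral>\<^sup>+x. u x \<partial>splitting_measure M G V)"
      using mult by (intro nn_integral_cmult)
    moreover have "u \<in> borel_measurable borel" by fact
    ultimately show ?case
      using mult by (simp only: nn_integral_cmult[OF borel_measurable_weight_sum])
  next
    case (add u v)
    have [measurable]: "u \<in> borel_measurable borel" "v \<in> borel_measurable borel" using add by simp_all
    have "(\<integral>\<^sup>+x. v x + u x \<partial>splitting_measure M G V) =
        (\<integral>\<^sup>+x. v x \<partial>splitting_measure M G V) + (\<integral>\<^sup>+x. u x \<partial>splitting_measure M G V)"
      using add by (intro nn_integral_add)
    moreover have "u \<in> borel_measurable borel" "v \<in> borel_measurable borel" by fact+
    ultimately show ?case
      using add by (simp only: distrib_left sum.distrib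
          nn_integral_add[OF borel_measurable_weight_sum borel_measurable_weight_sum])
  next
    case (seq U)
    have [measurable]: "U n \<in> borel_measurable borel" for n using seq by simp
    have S: "(SUP n. \<Sum>i=1..G w. ennreal (V i (G w) w) * U n (V i (G w) w)) =
        (\<Sum>i=1..G w. ennreal (V i (G w) w) * (SUP n. U n) (V i (G w) w))" for w
      using seq(3) unfolding SUP_apply SUP_mult_left_ennreal
      by (intro ennreal_SUP_sum) (auto simp: incseq_def le_fun_def intro!: mult_left_mono)
    have "(\<integral>\<^sup>+x. (SUP n. U n) x \<partial>splitting_measure M G V) =
        (SUP n. \<integral>\<^sup>+x. U n x \<partial>splitting_measure M G V)"
      using seq unfolding SUP_apply by (intro nn_integral_monotone_convergence_SUP) auto
    also have "\<dots> = (SUP n. \<integral>\<^sup>+w. (\<Sum>i=1..G w. ennreal (V i (G w) w) * U n (V i (G w) w)) \<partial>M)"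
      using seq by simp
    also have "\<dots> = (\<integral>\<^sup>+w. (SUP n. \<Sum>i=1..G w. ennreal (V i (G w) w) * U n (V i (G w) w)) \<partial>M)"
      using seq(3) by (intro nn_integral_monotone_convergence_SUP[symmetric] borel_measurable_weight_sum)
        (auto simp: incseq_def le_fun_def intro!: sum_mono mult_left_mono)
    finally show ?case by (simp only: S)
  qed
qed

lemma prob_space_splitting_measure: "prob_space (splitting_measure M G V)"
proof
  have "(\<Sum>i=1..G w. ennreal (V i (G w) w)) = 1" if "w \<in> space M" for w
    using that V_nonneg[OF G_ge_2] V_sum[OF G_ge_2] by (subst sum_ennreal) auto
  then show "emeasure (splitting_measure M G V) (space (splitting_measure M G V)) = 1"
    by (simp add: emeasure_splitting_measure emeasure_space_1 cong: nn_integral_cong)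
qed

lemma nn_integral_splitting_measure_conditional:
  assumes [measurable]: "f \<in> borel_measurable borel"
  shows "(\<integral>\<^sup>+x. f x \<partial>splitting_measure M G V) =
    (\<Sum>j. \<Sum>i=1..j + 2. ennreal (prob {w \<in> space M. G w = j + 2}) *
       (\<integral>\<^sup>+w. ennreal (V i (j + 2) w) * f (V i (j + 2) w) \<partial>M))"
proof -
  have m: "(\<lambda>w. indicator {l} (G w) * (ennreal (V i l w) * f (V i l w))) \<in> borel_measurable M"
    if l: "2 \<le> l" and i: "i \<in> {1..l}" for i l
  proof (intro borel_measurable_times_ennreal)
    show "(\<lambda>w. indicator {l} (G w) :: ennreal) \<in> borel_measurable M"
      by (rule measurable_compose[OF G_measurable]) simp
    show "(\<lambda>w. ennreal (V i l w)) \<in> borel_measurable M" "(\<lambda>w. f (V i l w)) \<in> borel_measurable M"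
      by (rule measurable_compose[OF V_measurable[OF l i]]; simp)+
  qed
  have E: "(\<integral>\<^sup>+w. indicator {l} (G w) * (ennreal (V i l w) * f (V i l w)) \<partial>M) =
      ennreal (prob {w \<in> space M. G w = l}) * (\<integral>\<^sup>+w. ennreal (V i l w) * f (V i l w) \<partial>M)"
    if l: "2 \<le> l" and i: "i \<in> {1..l}" for i l
  proof -
    have V [measurable]: "V i l \<in> borel_measurable M" using V_measurable l i by blast
    have indG [measurable]: "(\<lambda>w. indicator {l} (G w) :: ennreal) \<in> borel_measurable M"
      by (rule measurable_compose[OF G_measurable]) simp
    let ?p = "emeasure M {w \<in> space M. G w = l}"
    have "distr (density M (\<lambda>w. indicator {l} (G w))) borel (V i l) =
        scale_measure ?p (distr M borel (V i l))"
    proof (rule measure_eqI)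
      fix B assume "B \<in> sets (distr (density M (\<lambda>w. indicator {l} (G w))) borel (V i l))"
      then have B [measurable]: "B \<in> sets borel" by simp
      let ?X = "\<lambda>w. \<lambda>i\<in>{1..l}. V i l w"
      let ?GB = "{w \<in> space M. G w = l}" and ?VB = "{w \<in> space M. V i l w \<in> B}"
      have 1: "?GB \<in> sets (vimage_algebra (space M) G (count_space UNIV))"
        using in_vimage_algebra[of "{l}" "count_space UNIV" G "space M"]
        by (simp add: vimage_def Int_def conj_commute)
      have "(\<lambda>v. v i) -` B \<inter> space (\<Pi>\<^sub>M i\<in>{1..l}. borel) \<in> sets (\<Pi>\<^sub>M i\<in>{1..l}. (borel :: real measure))"
        using i by (intro measurable_sets[OF measurable_component_singleton]) auto
      from in_vimage_algebra[OF this, of ?X "space M"]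
      have "?X -` ((\<lambda>v. v i) -` B \<inter> space (\<Pi>\<^sub>M i\<in>{1..l}. borel)) \<inter> space M
          \<in> sets (vimage_algebra (space M) ?X (\<Pi>\<^sub>M i\<in>{1..l}. borel))" .
      moreover have "?X -` ((\<lambda>v. v i) -` B \<inter> space (\<Pi>\<^sub>M i\<in>{1..l}. borel)) \<inter> space M = ?VB"
        using i by (auto simp: space_PiM)
      ultimately have 2: "?VB \<in> sets (vimage_algebra (space M) ?X (\<Pi>\<^sub>M i\<in>{1..l}. borel))"
        by simp
      have "emeasure M (?GB \<inter> ?VB) = ?p * emeasure M ?VB"
        using indep_setD[OF G_V_indep[OF l] 1 2] by (simp add: emeasure_eq_measure ennreal_mult)
      moreover have "emeasure (distr (density M (\<lambda>w. indicator {l} (G w))) borel (V i l)) B =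
          emeasure M (?GB \<inter> ?VB)"
      proof -
        have "emeasure (density M (\<lambda>w. indicator {l} (G w))) (V i l -` B \<inter> space M) =
            (\<integral>\<^sup>+w. indicator (?GB \<inter> ?VB) w \<partial>M)"
          by (subst emeasure_density[OF indG]) (simp, intro nn_integral_cong, simp split: split_indicator)
        also have "\<dots> = emeasure M (?GB \<inter> ?VB)"
          by (rule nn_integral_indicator) simp
        finally show ?thesis
          by (subst emeasure_distr) (simp_all only: space_density, measurable)
      qed
      moreover have "V i l -` B \<inter> space M = ?VB" by auto
      ultimately show "emeasure (distr (density M (\<lambda>w. indicator {l} (G w))) borel (V i l)) B =
          emeasure (scale_measure ?p (distr M borel (V i l))) B"
        by (simp add: emeasure_distr)
    qed simp
    then have "(\<integral>\<^sup>+x. ennreal x * f x \<partial>distr (density M (\<lambda>w. indicator {l} (G w))) borel (V i l)) =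
        (\<integral>\<^sup>+x. ennreal x * f x \<partial>scale_measure ?p (distr M borel (V i l)))"
      by simp
    then show ?thesis
      by (simp add: nn_integral_distr nn_integral_density nn_integral_scale_measure
          emeasure_eq_measure)
  qed
  have "(\<integral>\<^sup>+x. f x \<partial>splitting_measure M G V) =
      (\<integral>\<^sup>+w. (\<Sum>i=1..G w. ennreal (V i (G w) w) * f (V i (G w) w)) \<partial>M)"
    by (simp add: nn_integral_splitting_measure)
  also have "\<dots> = (\<integral>\<^sup>+w. (\<Sum>j. \<Sum>i=1..j + 2.
      indicator {j + 2} (G w) * (ennreal (V i (j + 2) w) * f (V i (j + 2) w))) \<partial>M)"
  proof (rule nn_integral_cong)
    fix w assume "w \<in> space M"
    then have g: "G w - 2 + 2 = G w" using G_ge_2[of w] by simp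
    let ?F = "\<lambda>l. \<Sum>i=1..l. indicator {l} (G w) * (ennreal (V i l w) * f (V i l w))"
    have "(\<Sum>j. ?F (j + 2)) = (\<Sum>j\<in>{G w - 2}. ?F (j + 2))"
    proof (rule suminf_finite)
      fix j assume "j \<notin> {G w - 2}"
      then have "G w \<noteq> j + 2" by auto
      then show "?F (j + 2) = 0" by (intro sum.neutral) simp
    qed simp
    also have "\<dots> = ?F (G w - 2 + 2)"
      by (subst sum.insert[OF finite.emptyI]) (simp_all only: empty_iff not_False_eq_True sum.empty add_0_right)
    also have "\<dots> = ?F (G w)" by (simp only: g)
    also have "\<dots> = (\<Sum>i=1..G w. ennreal (V i (G w) w) * f (V i (G w) w))" by simp
    finally show "(\<Sum>i=1..G w. ennreal (V i (G w) w) * f (V i (G w) w)) = (\<Sum>j. \<Sum>i=1..j + 2.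
        indicator {j + 2} (G w) * (ennreal (V i (j + 2) w) * f (V i (j + 2) w)))" ..
  qed
  also have "\<dots> = (\<Sum>j. \<integral>\<^sup>+w. (\<Sum>i=1..j + 2.
      indicator {j + 2} (G w) * (ennreal (V i (j + 2) w) * f (V i (j + 2) w))) \<partial>M)"
    by (intro nn_integral_suminf borel_measurable_sum m) auto
  also have "\<dots> = (\<Sum>j. \<Sum>i=1..j + 2. ennreal (prob {w \<in> space M. G w = j + 2}) *
       (\<integral>\<^sup>+w. ennreal (V i (j + 2) w) * f (V i (j + 2) w) \<partial>M))"
  proof (intro suminf_cong)
    fix j
    have "(\<integral>\<^sup>+w. (\<Sum>i=1..j + 2.
        indicator {j + 2} (G w) * (ennreal (V i (j + 2) w) * f (V i (j + 2) w))) \<partial>M) =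
      (\<Sum>i=1..j + 2. \<integral>\<^sup>+w.
        indicator {j + 2} (G w) * (ennreal (V i (j + 2) w) * f (V i (j + 2) w)) \<partial>M)"
      by (intro nn_integral_sum m) auto
    also have "\<dots> = (\<Sum>i=1..j + 2. ennreal (prob {w \<in> space M. G w = j + 2}) *
       (\<integral>\<^sup>+w. ennreal (V i (j + 2) w) * f (V i (j + 2) w) \<partial>M))"
      by (intro sum.cong refl E) auto
    finally show "(\<integral>\<^sup>+w. (\<Sum>i=1..j + 2.
        indicator {j + 2} (G w) * (ennreal (V i (j + 2) w) * f (V i (j + 2) w))) \<partial>M) = \<dots>" .
  qed
  finally show ?thesis .
qed

lemma measurable_split_kernel:
  "(\<lambda>w. measure_pmf (split_pmf A n (G w) (\<lambda>i. V i (G w) w))) \<in> M \<rightarrow>\<^sub>M prob_algebra (count_space UNIV)"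
proof (rule measurable_G_cases)
  fix l :: nat assume l: "2 \<le> l"
  let ?S = "PiE_dflt {..<n} 0 (\<lambda>_. {1..l})"
  let ?Q = "\<lambda>c. Pi_pmf {1..l} 0 (\<lambda>_. A) \<bind>
    (\<lambda>a. return_pmf (map (\<lambda>i. card {k\<in>{..<n}. c k = i} + a i) [1..<Suc l]))"
  have [measurable]: "V i l \<in> borel_measurable M" if "i \<in> {1..l}" for i
    using V_measurable[OF l that] .
  have fin: "finite ?S" by (intro finite_PiE_dflt) auto
  have E: "emeasure (measure_pmf (split_pmf A n l (\<lambda>i. V i l w))) B =
      (\<Sum>c\<in>?S. emeasure (measure_pmf (?Q c)) B * ennreal (\<Prod>k<n. V (c k) l w))"
    if w: "w \<in> space M" for w B
  proof -
    let ?p = "Pi_pmf {..<n} 0 (\<lambda>_. weight_pmf l (\<lambda>i. V i l w))"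
    have pw: "pmf (weight_pmf l (\<lambda>i. V i l w)) i = (if i \<in> {1..l} then V i l w else 0)" for i
      using V_nonneg[OF l _ w] V_sum[OF l w] by (intro pmf_weight_pmf) auto
    have "set_pmf (weight_pmf l (\<lambda>i. V i l w)) \<subseteq> {1..l}"
      by (auto simp: set_pmf_eq pw split: if_splits)
    then have "PiE_dflt {..<n} 0 (set_pmf \<circ> (\<lambda>_. weight_pmf l (\<lambda>i. V i l w))) \<subseteq> ?S"
      unfolding PiE_dflt_def comp_def by blast
    then have sub: "set_pmf ?p \<subseteq> ?S"
      using set_Pi_pmf_subset'[OF finite_lessThan] by (rule order_trans[rotated])
    have pp: "pmf ?p c = (\<Prod>k<n. V (c k) l w)" if "c \<in> ?S" for c
      using that by (subst pmf_Pi') (auto simp: PiE_dflt_def pw intro!: prod.cong)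
    have "emeasure (measure_pmf (split_pmf A n l (\<lambda>i. V i l w))) B =
        (\<integral>\<^sup>+c. emeasure (measure_pmf (?Q c)) B \<partial>measure_pmf ?p)"
      unfolding split_pmf_def by (rule emeasure_bind_pmf)
    also have "\<dots> = (\<Sum>c\<in>?S. emeasure (measure_pmf (?Q c)) B * ennreal (pmf ?p c))"
      using sub fin by (intro nn_integral_measure_pmf_support) (auto simp: set_pmf_eq)
    finally show ?thesis by (simp add: pp)
  qed
  show "(\<lambda>w. measure_pmf (split_pmf A n l (\<lambda>i. V i l w))) \<in> M \<rightarrow>\<^sub>M prob_algebra (count_space UNIV)"
  proof (rule measurable_prob_algebraI)
    show "(\<lambda>w. measure_pmf (split_pmf A n l (\<lambda>i. V i l w))) \<in> M \<rightarrow>\<^sub>M subprob_algebra (count_space UNIV)"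
    proof (rule measurable_subprob_algebra)
      fix B :: "nat list set"
      have "(\<lambda>w. \<Sum>c\<in>?S. emeasure (measure_pmf (?Q c)) B * ennreal (\<Prod>k<n. V (c k) l w))
          \<in> borel_measurable M"
      proof (rule borel_measurable_sum)
        fix c assume "c \<in> ?S"
        then have "c k \<in> {1..l}" if "k \<in> {..<n}" for k
          using that by (auto simp: PiE_dflt_def)
        then have [measurable]: "(\<lambda>w. \<Prod>k<n. V (c k) l w) \<in> borel_measurable M"
          by (intro borel_measurable_prod V_measurable[OF l]) auto
        show "(\<lambda>w. emeasure (measure_pmf (?Q c)) B * ennreal (\<Prod>k<n. V (c k) l w))
            \<in> borel_measurable M"
          by measurable
      qed
      then show "(\<lambda>w. emeasure (measure_pmf (split_pmf A n l (\<lambda>i. V i l w))) B) \<in> borel_measurable M"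
        by (simp only: E cong: measurable_cong)
    qed (auto intro: measure_pmf.subprob_space_axioms)
  qed (auto intro: measure_pmf.prob_space_axioms)
qed

lemma prob_space_split_law: "prob_space (split_law M G V A n)"
  and sets_split_law [simp, measurable_cong]: "sets (split_law M G V A n) = UNIV"
proof -
  have M: "M \<in> space (prob_algebra M)"
    by (simp add: space_prob_algebra prob_space_axioms)
  show "prob_space (split_law M G V A n)" "sets (split_law M G V A n) = UNIV"
    unfolding split_law_def
    using prob_space_bind'[OF M measurable_split_kernel] sets_bind'[OF M measurable_split_kernel]
    by simp_all
qed

lemma prob_space_tree_space: "prob_space (tree_space M G V A)"
  unfolding tree_space_def by (intro prob_space_PiM) (auto simp: prob_space_split_law)

end

end

theory Submission
  imports Defs
begin

text \<open>
  The mean number of nodes is dominated by a Lyapunov function. If \<open>h \<ge> 1\<close> and if, for every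
  \<open>m \<ge> D\<close>, one plus the mean of \<open>h\<close> summed over the children of a node with \<open>m\<close> items is at most
  \<open>h m\<close>, then every splitting pays for the node that is split, and the mean of the sum of \<open>h\<close>
  over a generation, increased by the mean sizes of the previous ones, never exceeds \<open>h n\<close>. Hence the
  mean number of nodes is at most \<open>h n\<close> (\<open>mean_nodes_le_supersolution\<close>).

  The function used here is \<open>h 0 = 1\<close> and \<open>h m = (K + 1) m - K\<close> for \<open>m \<ge> 1\<close>. Without arrivals the
  linear part is conserved by a splitting, whereas \<open>- K\<close> is counted once per nonempty child. There is
  always one of these, and there are two as soon as the items \<open>0\<close> and \<open>1\<close> go to different children.
  Since the weights are at most \<open>\<delta> < 1\<close>, this has probability at least \<open>1 - \<delta>\<close> whatever \<open>m \<ge> 2\<close> is,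
  so that a splitting gains at least \<open>K (1 - \<delta>)\<close> in the mean. It costs \<open>1\<close> for the node, at most \<open>E G\<close> for the
  empty children, and at most \<open>(K + 1) E A E G\<close> for the arrivals. The choice
  \<open>K (1 - \<delta>) = 1 + 2 E G\<close> makes the balance favourable as soon as \<open>(K + 1) E A \<le> 1\<close>
  (\<open>potential_drift\<close>).

  Two facts make this work. The mean degree \<open>E G\<close> is finite: the children of positive weight number
  \<open>\<integral> 1 / x dW\<close> in the mean, and \<open>\<bar>ln x\<bar> \<ge> \<bar>ln \<delta>\<bar> > 0\<close> on the support of the splitting measure \<open>W\<close>
  (\<open>nn_integral_num_children_finite\<close>). Moreover \<open>E A = P(A > 0) E(A | A > 0)\<close> tends to \<open>0\<close> with
  \<open>\<epsilon>\<close> (\<open>eventually_expectation_le\<close>). As \<open>K\<close> depends on the branching mechanism alone, the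
  resulting bound \<open>h n \<le> (K + 1) n\<close> is uniform in \<open>\<epsilon>\<close>; this linear growth makes the Poisson transform
  an everywhere convergent power series times \<open>exp (- x)\<close>.
\<close>


section \<open>Integrability of the number of children\<close>

context branching_mechanism
begin

text \<open>
  Under the splitting measure a weight is charged in proportion to its value, so only weights equal
  to \<open>0\<close> could escape its support, and \<open>0\<close> is below \<open>\<delta>\<close>.
\<close>

lemma AE_weights_le:
  assumes "measure (splitting_measure M G V) {0..\<delta>} = 1"
  shows "AE w in M. \<forall>i\<in>{1..G w}. V i (G w) w \<le> \<delta>"
proof -
  interpret S: prob_space "splitting_measure M G V"
    by (rule prob_space_splitting_measure)
  let ?f = "\<lambda>w. \<Sum>i=1..G w. ennreal (V i (G w) w) * indicator (- {0..\<delta>}) (V i (G w) w)"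
  have "S.prob (- {0..\<delta>}) = 0"
    using assms S.prob_compl[of "{0..\<delta>}"] by (simp add: Compl_eq_Diff_UNIV)
  then have "emeasure (splitting_measure M G V) (- {0..\<delta>}) = 0"
    by (simp add: S.emeasure_eq_measure)
  then have "(\<integral>\<^sup>+w. ?f w \<partial>M) = 0"
    by (simp add: emeasure_splitting_measure)
  moreover have "?f \<in> borel_measurable M"
    by (rule borel_measurable_weight_sum) simp
  ultimately have "AE w in M. ?f w = 0"
    by (simp add: nn_integral_0_iff_AE)
  then show ?thesis
  proof eventually_elim
    case (elim w)
    show ?case
    proof (rule ballI, rule ccontr)
      fix i assume i: "i \<in> {1..G w}" and "\<not> V i (G w) w \<le> \<delta>"
      moreover have "ennreal (V i (G w) w) * indicator (- {0..\<delta>}) (V i (G w) w) = 0"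
        using elim i by (subst (asm) sum_eq_0_iff) auto
      ultimately have "V i (G w) w \<le> 0" and "V i (G w) w \<notin> {0..\<delta>}"
        by (auto simp: indicator_def ennreal_eq_0_iff split: if_splits)
      moreover have "0 \<le> \<delta>"
        using assms by (cases "0 \<le> \<delta>") auto
      ultimately show False
        using \<open>\<not> V i (G w) w \<le> \<delta>\<close> by auto
    qed
  qed
qed

text \<open>
  A child of weight \<open>v > 0\<close> contributes \<open>1 = v * (1 / v)\<close>, and these contributions add up to an
  integral against the splitting measure. The children of weight \<open>0\<close>, which this measure does not
  see, are counted apart.
\<close>

lemma nn_integral_num_children_finite:
  assumes zero: "(\<integral>\<^sup>+w. of_nat (card {i \<in> {1..G w}. V i (G w) w = 0}) \<partial>M) < \<infinity>"
    and le: "AE w in M. \<forall>i\<in>{1..G w}. V i (G w) w \<le> \<delta>" and \<delta>: "0 < \<delta>" "\<delta> < 1"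
    and log: "(\<integral>\<^sup>+x\<in>{0..1}. ennreal (\<bar>ln x\<bar> / x) \<partial>splitting_measure M G V) < \<infinity>"
  shows "(\<integral>\<^sup>+w. of_nat (G w) \<partial>M) < \<infinity>"
proof -
  let ?f = "\<lambda>x::real. ennreal (\<bar>ln x\<bar> / x) * indicator {0..1} x"
  define S where "S w = (\<Sum>i=1..G w. ennreal (V i (G w) w) * ?f (V i (G w) w))" for w
  define Z where "Z w = (of_nat (card {i \<in> {1..G w}. V i (G w) w = 0}) :: ennreal)" for w
  define L where "L = 1 / \<bar>ln \<delta>\<bar>"
  have "ln \<delta> < 0" using \<delta> by simp
  then have L: "0 < L" by (simp add: L_def)
  have [measurable]: "S \<in> borel_measurable M"
    unfolding S_def by (rule borel_measurable_weight_sum) measurable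
  have num_zero: "(of_nat (card {i \<in> {1..l}. V i l w = 0}) :: ennreal)
      = (\<Sum>i\<in>{1..l}. indicator {0} (V i l w))" for l w
  proof -
    have "(of_nat (card {i \<in> {1..l}. V i l w = 0}) :: ennreal) = (\<Sum>i\<in>{i \<in> {1..l}. V i l w = 0}. 1)"
      by simp
    also have "\<dots> = (\<Sum>i\<in>{1..l}. if V i l w = 0 then 1 else 0)"
      by (rule sum.inter_filter) simp
    also have "\<dots> = (\<Sum>i\<in>{1..l}. indicator {0} (V i l w))"
      by (intro sum.cong) auto
    finally show ?thesis .
  qed
  have [measurable]: "Z \<in> borel_measurable M"
    unfolding Z_def
  proof (rule measurable_G_cases)
    fix l :: nat assume l: "2 \<le> l"
    have [measurable]: "V i l \<in> borel_measurable M" if "i \<in> {1..l}" for i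
      using V_measurable[OF l that] .
    have "(\<lambda>w. \<Sum>i\<in>{1..l}. indicator {0} (V i l w) :: ennreal) \<in> borel_measurable M"
      by measurable
    then show "(\<lambda>w. of_nat (card {i \<in> {1..l}. V i l w = 0}) :: ennreal) \<in> borel_measurable M"
      by (simp only: num_zero)
  qed
  have "AE w in M. of_nat (G w) \<le> Z w + ennreal L * S w"
    using le AE_space
  proof eventually_elim
    case (elim w)
    let ?v = "\<lambda>i. V i (G w) w"
    \<comment> \<open>Positive weights are at most \<open>\<delta>\<close>, where the logarithm is bounded away from \<open>0\<close>.\<close>
    have *: "1 \<le> indicator {0} (?v i) + ennreal L * (ennreal (?v i) * ?f (?v i))"
      if i: "i \<in> {1..G w}" for i
    proof (cases "?v i = 0")
      case False
      then have v: "0 < ?v i" "?v i \<le> \<delta>"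
        using elim i V_nonneg[OF G_ge_2 i] by fastforce+
      then have "ln (?v i) \<le> ln \<delta>" using \<delta> by simp
      then have ln_le: "\<bar>ln \<delta>\<bar> \<le> \<bar>ln (?v i)\<bar>" using \<open>ln \<delta> < 0\<close> by simp
      define q where "q = \<bar>ln (?v i)\<bar> / ?v i"
      have "?v i \<in> {0..1}" using v \<delta> by auto
      then have f: "?f (?v i) = ennreal q"
        by (simp only: q_def indicator_simps mult_1_right)
      have q: "0 \<le> q" using v by (simp add: q_def)
      have "1 \<le> L * (?v i * q)"
        using v \<open>ln \<delta> < 0\<close> ln_le by (simp add: L_def q_def field_simps)
      then have "ennreal 1 \<le> ennreal (L * (?v i * q))"
        by (rule ennreal_leI)
      also have "\<dots> = ennreal L * (ennreal (?v i) * ennreal q)"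
        using v L q by (simp add: ennreal_mult)
      also have "\<dots> = ennreal L * (ennreal (?v i) * ?f (?v i))"
        by (simp only: f)
      finally have "1 \<le> ennreal L * (ennreal (?v i) * ?f (?v i))"
        by (simp only: ennreal_1)
      then show ?thesis by (intro add_increasing zero_le)
    qed simp
    have "(of_nat (G w) :: ennreal) = (\<Sum>i=1..G w. 1)" by simp
    also have "\<dots> \<le> (\<Sum>i=1..G w. indicator {0} (?v i) + ennreal L * (ennreal (?v i) * ?f (?v i)))"
      by (intro sum_mono *)
    also have "\<dots> = Z w + ennreal L * S w"
      by (simp only: Z_def S_def num_zero sum.distrib sum_distrib_left)
    finally show ?case .
  qed
  then have "(\<integral>\<^sup>+w. of_nat (G w) \<partial>M) \<le> (\<integral>\<^sup>+w. Z w + ennreal L * S w \<partial>M)"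
    by (rule nn_integral_mono_AE)
  also have "\<dots> = (\<integral>\<^sup>+w. Z w \<partial>M) + ennreal L * (\<integral>\<^sup>+w. S w \<partial>M)"
    by (simp add: nn_integral_add nn_integral_cmult)
  finally have *: "(\<integral>\<^sup>+w. of_nat (G w) \<partial>M) \<le> (\<integral>\<^sup>+w. Z w \<partial>M) + ennreal L * (\<integral>\<^sup>+w. S w \<partial>M)" .
  have "(\<integral>\<^sup>+w. S w \<partial>M) < \<infinity>"
    using log unfolding S_def by (subst nn_integral_splitting_measure[symmetric]) auto
  then have "(\<integral>\<^sup>+w. Z w \<partial>M) + ennreal L * (\<integral>\<^sup>+w. S w \<partial>M) < \<infinity>"
    using zero by (simp add: Z_def ennreal_mult_less_top)
  with * show ?thesis by (rule le_less_trans)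
qed

end


section \<open>Drift of the potential in one splitting step\<close>

text \<open>
  The term \<open>- K\<close> rewards a splitting for each nonempty child. The value \<open>1\<close> at \<open>0\<close> accounts for an
  empty child, which is a leaf but still a node.
\<close>

definition potential :: "real \<Rightarrow> nat \<Rightarrow> real" where
  "potential K n = (if n = 0 then 1 else (K + 1) * real n - K)"

lemma potential_ge_1: "0 \<le> K \<Longrightarrow> 1 \<le> potential K n"
proof (cases n)
  case (Suc j)
  assume "0 \<le> K"
  then have "0 \<le> (K + 1) * real j" by simp
  then show ?thesis by (simp add: potential_def Suc algebra_simps)
qed (simp add: potential_def)

text \<open>
  An item entering an empty node raises the potential from \<open>1\<close> to \<open>1\<close>, any other one by \<open>K + 1\<close>: an
  arrival costs at most \<open>K + 1\<close>, independently of the node that it enters.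
\<close>

lemma potential_add_le:
  assumes "0 \<le> K"
  shows "potential K (a + b) \<le> potential K a + (K + 1) * real b"
  using assms by (auto simp: potential_def algebra_simps)

text \<open>
  At most \<open>l\<close> children are empty, and at least two are not, unless the items \<open>0\<close> and \<open>1\<close> are
  together.
\<close>

lemma sum_potential_occupancy_le:
  assumes c: "c ` {..<m} \<subseteq> {1..l}" and m: "2 \<le> m" and K: "0 \<le> K"
  shows "(\<Sum>i=1..l. potential K (card {k\<in>{..<m}. c k = i}))
    \<le> (K + 1) * real m - 2 * K + real l + K * indicator {c. c 0 = c (1::nat)} c"
proof -
  let ?N = "\<lambda>i. card {k\<in>{..<m}. c k = i}"
  let ?J = "{i\<in>{1..l}. ?N i \<noteq> 0}"
  have "potential K n \<le> (K + 1) * real n + 1 - K * of_bool (n \<noteq> 0)" for n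
    using K by (simp add: potential_def)
  then have "(\<Sum>i=1..l. potential K (?N i))
      \<le> (\<Sum>i=1..l. (K + 1) * real (?N i) + 1 - K * of_bool (?N i \<noteq> 0))"
    by (intro sum_mono)
  also have "\<dots> = (K + 1) * real (\<Sum>i=1..l. ?N i) + real l - K * real (\<Sum>i=1..l. of_bool (?N i \<noteq> 0))"
    by (simp add: sum.distrib sum_subtractf sum_distrib_left)
  also have "(\<Sum>i=1..l. ?N i) = m"
    using sum.group[OF _ _ c, of "\<lambda>_. 1::nat"] by simp
  also have "(\<Sum>i=1..l. of_bool (?N i \<noteq> 0)) = card ?J"
    by (simp add: Int_def)
  finally have 1: "(\<Sum>i=1..l. potential K (?N i)) \<le> (K + 1) * real m + real l - K * real (card ?J)" .
  have "{c 0, c 1} \<subseteq> ?J"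
    using c m by (force simp: image_subset_iff)
  then have "card {c 0, c 1} \<le> card ?J"
    by (intro card_mono) auto
  then have "K * real (card {c 0, c 1}) \<le> K * real (card ?J)"
    using K by (intro mult_left_mono) auto
  moreover have "real (card {c 0, c 1}) = 2 - indicator {c. c 0 = c 1} c"
    by (simp add: indicator_def)
  ultimately have "K * (2 - indicator {c. c 0 = c 1} c) \<le> K * real (card ?J)"
    by simp
  then show ?thesis
    using 1 by (simp only: right_diff_distrib)
qed

text \<open>Given the choice of item \<open>1\<close>, item \<open>0\<close> makes the same choice with probability at most \<open>\<delta>\<close>.\<close>

lemma nn_integral_same_child_le:
  assumes p: "\<And>i. pmf p i \<le> \<delta>" and m: "2 \<le> m"
  shows "(\<integral>\<^sup>+c. indicator {c. c 0 = c (1::nat)} c \<partial>Pi_pmf {..<m} d (\<lambda>_. p)) \<le> ennreal \<delta>"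
proof -
  have "{..<m} = insert 0 {1..<m}" using m by auto
  then have "Pi_pmf {..<m} d (\<lambda>_. p) =
      Pi_pmf {1..<m} d (\<lambda>_. p) \<bind> (\<lambda>f. p \<bind> (\<lambda>y. return_pmf (f(0 := y))))"
    by (simp add: Pi_pmf_insert' bind_commute_pmf[of p])
  then have "(\<integral>\<^sup>+c. indicator {c. c 0 = c 1} c \<partial>Pi_pmf {..<m} d (\<lambda>_. p)) =
      (\<integral>\<^sup>+f. \<integral>\<^sup>+y. indicator {f 1} y \<partial>p \<partial>Pi_pmf {1..<m} d (\<lambda>_. p))"
    by (simp add: indicator_def)
  also have "\<dots> = (\<integral>\<^sup>+f. ennreal (pmf p (f 1)) \<partial>Pi_pmf {1..<m} d (\<lambda>_. p))"
    by (simp add: emeasure_pmf_single)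
  also have "\<dots> \<le> (\<integral>\<^sup>+f. ennreal \<delta> \<partial>Pi_pmf {1..<m} d (\<lambda>_. p))"
    by (intro nn_integral_mono ennreal_leI p)
  also have "\<dots> = ennreal \<delta>" by simp
  finally show ?thesis .
qed

text \<open>
  The weights and the number \<open>l\<close> of children are fixed here. In the bound, \<open>of_nat l\<close> comes from the
  empty children and the other term in \<open>l\<close> from the arrivals.
\<close>

lemma nn_integral_split_pmf_potential_le:
  fixes A :: "nat pmf"
  assumes v: "\<And>i. i \<in> {1..l} \<Longrightarrow> 0 \<le> v i" "\<And>i. i \<in> {1..l} \<Longrightarrow> v i \<le> \<delta>" "(\<Sum>i=1..l. v i) = 1"
    and m: "2 \<le> m" and K: "0 \<le> K" and \<delta>: "0 \<le> \<delta>"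
  shows "(\<integral>\<^sup>+x. (\<Sum>y\<leftarrow>x. ennreal (potential K y)) \<partial>split_pmf A m l v)
    \<le> ennreal ((K + 1) * real m - 2 * K + K * \<delta>)
      + of_nat l * (1 + ennreal (K + 1) * (\<integral>\<^sup>+k. of_nat k \<partial>A))"
proof -
  let ?N = "\<lambda>c i. card {k\<in>{..<m}. c k = i}"
  let ?W = "Pi_pmf {..<m} 0 (\<lambda>_. weight_pmf l v)"
  let ?A = "Pi_pmf {1..l} 0 (\<lambda>_. A)"
  let ?B = "(K + 1) * real m - 2 * K"
  let ?\<mu> = "\<integral>\<^sup>+k. of_nat k \<partial>A"
  have B: "0 \<le> ?B"
  proof -
    have "(K + 1) * 2 \<le> (K + 1) * real m" using m K by (intro mult_left_mono) auto
    then show ?thesis by (simp add: algebra_simps)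
  qed
  have pw: "pmf (weight_pmf l v) i = (if i \<in> {1..l} then v i else 0)" for i
    using v by (intro pmf_weight_pmf) auto
  have pot0: "0 \<le> potential K n" for n
    using potential_ge_1[OF K, of n] by simp
  have arrivals: "(\<integral>\<^sup>+a. of_nat (a i) \<partial>?A) = ?\<mu>" if "i \<in> {1..l}" for i
  proof -
    have "(\<integral>\<^sup>+a. of_nat (a i) \<partial>?A) = (\<integral>\<^sup>+k. of_nat k \<partial>map_pmf (\<lambda>a. a i) ?A)"
      by simp
    then show ?thesis using that by (simp only: Pi_pmf_component finite_atLeastAtMost if_True)
  qed
  have occ: "(\<Sum>i=1..l. ennreal (potential K (?N c i)))
      \<le> ennreal ?B + of_nat l + ennreal K * indicator {c. c 0 = c 1} c" if "c \<in> set_pmf ?W" for c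
  proof -
    have "c k \<in> {1..l}" if "k < m" for k
      using \<open>c \<in> set_pmf ?W\<close> that pw[of "c k"]
      by (auto simp: set_Pi_pmf PiE_dflt_def set_pmf_iff split: if_splits)
    then have "c ` {..<m} \<subseteq> {1..l}" by auto
    then have "ennreal (\<Sum>i=1..l. potential K (?N c i))
        \<le> ennreal (?B + real l + K * indicator {c. c 0 = c 1} c)"
      by (intro ennreal_leI sum_potential_occupancy_le m K)
    also have "\<dots> = ennreal ?B + of_nat l + ennreal K * indicator {c. c 0 = c 1} c"
      using B K by (simp add: ennreal_mult ennreal_of_nat_eq_real_of_nat flip: ennreal_indicator)
    finally show ?thesis using pot0 by simp
  qed
  have "(\<integral>\<^sup>+x. (\<Sum>y\<leftarrow>x. ennreal (potential K y)) \<partial>split_pmf A m l v)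
      = (\<integral>\<^sup>+c. \<integral>\<^sup>+a. (\<Sum>i=1..l. ennreal (potential K (?N c i + a i))) \<partial>?A \<partial>?W)"
    by (simp add: split_pmf_def comp_def interv_sum_list_conv_sum_set_nat atLeastLessThanSuc_atLeastAtMost
        del: upt_Suc)
  also have "\<dots> \<le> (\<integral>\<^sup>+c. \<integral>\<^sup>+a. (\<Sum>i=1..l. ennreal (potential K (?N c i)) + ennreal (K + 1) * of_nat (a i)) \<partial>?A \<partial>?W)"
  proof (intro nn_integral_mono sum_mono)
    fix c a i
    have "ennreal (potential K (?N c i + a i)) \<le> ennreal (potential K (?N c i) + (K + 1) * real (a i))"
      by (intro ennreal_leI potential_add_le K)
    also have "\<dots> = ennreal (potential K (?N c i)) + ennreal (K + 1) * of_nat (a i)"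
      using K pot0 by (simp add: ennreal_mult ennreal_of_nat_eq_real_of_nat)
    finally show "ennreal (potential K (?N c i + a i))
        \<le> ennreal (potential K (?N c i)) + ennreal (K + 1) * of_nat (a i)" .
  qed
  also have "\<dots> = (\<integral>\<^sup>+c. (\<Sum>i=1..l. ennreal (potential K (?N c i)) + ennreal (K + 1) * ?\<mu>) \<partial>?W)"
  proof (rule nn_integral_cong)
    fix c
    have "(\<integral>\<^sup>+a. ennreal (potential K (?N c i)) + ennreal (K + 1) * of_nat (a i) \<partial>?A)
        = ennreal (potential K (?N c i)) + ennreal (K + 1) * (\<integral>\<^sup>+a. of_nat (a i) \<partial>?A)" for i
      by (simp add: nn_integral_add nn_integral_cmult)
    then show "(\<integral>\<^sup>+a. (\<Sum>i=1..l. ennreal (potential K (?N c i)) + ennreal (K + 1) * of_nat (a i)) \<partial>?A)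
        = (\<Sum>i=1..l. ennreal (potential K (?N c i)) + ennreal (K + 1) * ?\<mu>)"
      by (subst nn_integral_sum) (simp_all only: arrivals measurable_pmf_measure1 UNIV_I Pi_I space_borel cong: sum.cong)
  qed
  also have "\<dots> \<le> (\<integral>\<^sup>+c. (ennreal ?B + of_nat l + of_nat l * (ennreal (K + 1) * ?\<mu>))
      + ennreal K * indicator {c. c 0 = c 1} c \<partial>?W)"
    using occ by (intro nn_integral_mono_AE AE_pmfI) (simp add: sum.distrib add_right_mono ac_simps)
  also have "\<dots> = ennreal ?B + of_nat l + of_nat l * (ennreal (K + 1) * ?\<mu>)
      + ennreal K * (\<integral>\<^sup>+c. indicator {c. c 0 = c 1} c \<partial>?W)"
    by (simp add: nn_integral_add nn_integral_cmult)
  also have "\<dots> \<le> ennreal ?B + of_nat l + of_nat l * (ennreal (K + 1) * ?\<mu>) + ennreal K * ennreal \<delta>"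
    using \<delta> v by (intro add_left_mono mult_left_mono nn_integral_same_child_le m) (auto simp: pw)
  also have "\<dots> = ennreal (?B + K * \<delta>) + of_nat l * (1 + ennreal (K + 1) * ?\<mu>)"
    using B K \<delta> by (simp add: ennreal_mult ring_distribs ac_simps)
  finally show ?thesis .
qed

text \<open>
  The gain \<open>K * (1 - \<delta>)\<close> of a splitting pays for the node (\<open>1\<close>), for the empty children (\<open>\<gamma>\<close>) and for
  the arrivals (\<open>\<gamma>\<close> again, one unit per child).
\<close>

lemma (in branching_mechanism) potential_drift:
  fixes A :: "nat pmf"
  assumes le: "AE w in M. \<forall>i\<in>{1..G w}. V i (G w) w \<le> \<delta>" and \<delta>: "0 \<le> \<delta>"
    and \<gamma>: "(\<integral>\<^sup>+w. of_nat (G w) \<partial>M) = ennreal \<gamma>" "0 \<le> \<gamma>"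
    and K: "0 \<le> K" "1 + 2 * \<gamma> \<le> K * (1 - \<delta>)"
    and A: "ennreal (K + 1) * (\<integral>\<^sup>+k. of_nat k \<partial>A) \<le> 1" and m: "2 \<le> m"
  shows "1 + (\<integral>\<^sup>+x. (\<Sum>y\<leftarrow>x. ennreal (potential K y)) \<partial>split_law M G V A m) \<le> ennreal (potential K m)"
proof -
  let ?h = "\<lambda>x. \<Sum>y\<leftarrow>x. ennreal (potential K y)"
  let ?B = "(K + 1) * real m - 2 * K + K * \<delta>"
  have B: "0 \<le> ?B"
  proof -
    have "(K + 1) * 2 \<le> (K + 1) * real m" using m K by (intro mult_left_mono) auto
    moreover have "0 \<le> K * \<delta>" using K(1) \<delta> by simp
    ultimately show ?thesis using K(1) by (simp add: algebra_simps)
  qed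
  have "(\<integral>\<^sup>+x. ?h x \<partial>split_law M G V A m) =
      (\<integral>\<^sup>+w. \<integral>\<^sup>+x. ?h x \<partial>split_pmf A m (G w) (\<lambda>i. V i (G w) w) \<partial>M)"
    unfolding split_law_def
    by (rule nn_integral_bind[OF _ measurable_prob_algebraD[OF measurable_split_kernel]]) simp
  also have "\<dots> \<le> (\<integral>\<^sup>+w. ennreal ?B + of_nat (G w) * 2 \<partial>M)"
  proof (rule nn_integral_mono_AE, use le AE_space in eventually_elim)
    case (elim w)
    have "(\<integral>\<^sup>+x. ?h x \<partial>split_pmf A m (G w) (\<lambda>i. V i (G w) w))
        \<le> ennreal ?B + of_nat (G w) * (1 + ennreal (K + 1) * (\<integral>\<^sup>+k. of_nat k \<partial>A))"
      using elim V_nonneg[OF G_ge_2] V_sum[OF G_ge_2]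
      by (intro nn_integral_split_pmf_potential_le m K \<delta>) auto
    also have "\<dots> \<le> ennreal ?B + of_nat (G w) * (1 + 1)"
      by (intro add_left_mono mult_left_mono A) auto
    finally show ?case by simp
  qed
  also have "\<dots> = ennreal ?B + ennreal \<gamma> * 2"
    by (simp add: nn_integral_add nn_integral_multc emeasure_space_1 \<gamma>)
  also have "\<dots> = ennreal (?B + 2 * \<gamma>)"
    using B \<gamma>(2) by (simp add: ennreal_mult mult.commute)
  finally have "1 + (\<integral>\<^sup>+x. ?h x \<partial>split_law M G V A m) \<le> 1 + ennreal (?B + 2 * \<gamma>)"
    by (intro add_left_mono)
  also have "\<dots> = ennreal (1 + (?B + 2 * \<gamma>))"
    using B \<gamma>(2) by (simp flip: ennreal_1)
  also have "\<dots> \<le> ennreal (potential K m)"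
    using K(2) m by (intro ennreal_leI) (simp add: potential_def algebra_simps)
  finally show ?thesis .
qed

section \<open>Nodes of the tree by generations\<close>

text \<open>
  Invariance of \<open>g\<close> under updates of coordinate \<open>j\<close> expresses that \<open>g\<close> depends on the other coordinates
  only. The space is split into coordinate \<open>j\<close> and the rest, to which Fubini's theorem applies; the
  points of the rest are undefined at \<open>j\<close>, which \<open>g\<close> does not notice.
\<close>

lemma nn_integral_PiM_indep_component:
  assumes N: "\<And>i. i \<in> I \<Longrightarrow> prob_space (N i)" and j: "j \<in> I"
    and f [measurable]: "f \<in> borel_measurable (N j)"
    and g [measurable]: "g \<in> borel_measurable (PiM I N)"
    and upd: "\<And>s x. g (s(j := x)) = g s"
  shows "(\<integral>\<^sup>+s. f (s j) * g s \<partial>PiM I N) = (\<integral>\<^sup>+x. f x \<partial>N j) * (\<integral>\<^sup>+s. g s \<partial>PiM I N)"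
proof -
  let ?P = "PiM (I - {j}) N"
  interpret Nj: prob_space "N j" using N j by blast
  interpret P: prob_space ?P using N by (intro prob_space_PiM) auto
  have I: "insert j (I - {j}) = I" using j by auto
  have [measurable]: "(\<lambda>(x, X). X(j := x)) \<in> N j \<Otimes>\<^sub>M ?P \<rightarrow>\<^sub>M PiM I N"
    using measurable_compose[OF measurable_pair_swap' measurable_add_dim[of j "I - {j}" N]]
    by (simp only: I) (simp add: split_beta')
  have D: "distr (N j \<Otimes>\<^sub>M ?P) (PiM I N) (\<lambda>(x, X). X(j := x)) = PiM I N"
    using distr_pair_PiM_eq_PiM[of "I - {j}" N j] N j unfolding I by blast
  have *: "(\<integral>\<^sup>+s. F (s j) * g s \<partial>PiM I N) = (\<integral>\<^sup>+x. F x \<partial>N j) * (\<integral>\<^sup>+X. g X \<partial>?P)"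
    if [measurable]: "F \<in> borel_measurable (N j)" for F
  proof -
    have [measurable]: "(\<lambda>s. s j) \<in> PiM I N \<rightarrow>\<^sub>M N j"
      using j by (rule measurable_component_singleton)
    have "(\<integral>\<^sup>+s. F (s j) * g s \<partial>PiM I N)
        = (\<integral>\<^sup>+z. F (fst z) * g ((snd z)(j := fst z)) \<partial>(N j \<Otimes>\<^sub>M ?P))"
      by (subst D[symmetric], subst nn_integral_distr) (auto simp: split_beta')
    also have "\<dots> = (\<integral>\<^sup>+x. \<integral>\<^sup>+X. F x * g (X(j := x)) \<partial>?P \<partial>N j)"
      by (subst P.nn_integral_fst[symmetric]) (auto simp: split_beta')
    also have "\<dots> = (\<integral>\<^sup>+x. F x * (\<integral>\<^sup>+X. g X \<partial>?P) \<partial>N j)"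
    proof (rule nn_integral_cong)
      fix x assume x: "x \<in> space (N j)"
      then have "(\<lambda>X. (\<lambda>(x, X). X(j := x)) (x, X)) \<in> ?P \<rightarrow>\<^sub>M PiM I N"
        by (intro measurable_compose[OF measurable_Pair1'[OF x]]) measurable
      from measurable_compose[OF this g] have "(\<lambda>X. g (X(j := x))) \<in> borel_measurable ?P" by simp
      then show "(\<integral>\<^sup>+X. F x * g (X(j := x)) \<partial>?P) = F x * (\<integral>\<^sup>+X. g X \<partial>?P)"
        by (simp add: upd nn_integral_cmult)
    qed
    also have "\<dots> = (\<integral>\<^sup>+x. F x \<partial>N j) * (\<integral>\<^sup>+X. g X \<partial>?P)"
      by (simp add: nn_integral_multc)
    finally show ?thesis .
  qed
  \<comment> \<open>The instance \<open>F = 1\<close> identifies the integral of \<open>g\<close> over the rest with that over the full space.\<close>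
  show ?thesis
    using *[OF f] *[of "\<lambda>_. 1"] by (simp add: Nj.emeasure_space_1)
qed

lemma nn_integral_count_space_lists:
  assumes "f [] = 0"
  shows "(\<integral>\<^sup>+v. f v \<partial>count_space UNIV) = (\<integral>\<^sup>+u. \<integral>\<^sup>+i. f (i # u) \<partial>count_space UNIV \<partial>count_space UNIV)"
proof -
  let ?c = "\<lambda>(u, i). i # u"
  have "v = []" if "v \<notin> range ?c" for v
    using that by (cases v) (auto simp: image_iff)
  then have "(\<integral>\<^sup>+v. f v \<partial>count_space UNIV) = (\<integral>\<^sup>+v. f v \<partial>count_space (range ?c))"
    using assms by (intro nn_integral_count_space_eq) blast+
  also have "\<dots> = (\<integral>\<^sup>+z. f (?c z) \<partial>count_space UNIV)"
    by (rule nn_integral_bij_count_space[symmetric]) (auto intro!: inj_on_imp_bij_betw injI)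
  also have "\<dots> = (\<integral>\<^sup>+u. \<integral>\<^sup>+i. f (?c (u, i)) \<partial>count_space UNIV \<partial>count_space UNIV)"
    by (rule nn_integral_fst_count_space[symmetric])
  finally show ?thesis by simp
qed

text \<open>The content of \<open>u\<close> is determined by the outcomes at strict ancestors, whose paths are shorter.\<close>

lemma items_upd_later:
  "length u \<le> length u' \<Longrightarrow> items D n (s((u', m) := x)) u = items D n s u"
  by (induction u) (auto split: option.split)

context branching_mechanism
begin

lemma borel_measurable_split_law: "f \<in> borel_measurable (split_law M G V A m)"
  by (simp add: measurable_def)

lemma measurable_outcome: "(\<lambda>s. s (u, m)) \<in> tree_space M G V A \<rightarrow>\<^sub>M count_space UNIV"
proof -
  have "(\<lambda>s. s (u, m)) \<in> tree_space M G V A \<rightarrow>\<^sub>M split_law M G V A m"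
    using measurable_component_singleton[of "(u, m)" UNIV "\<lambda>(u, m). split_law M G V A m"]
    by (simp add: tree_space_def)
  moreover have "(tree_space M G V A \<rightarrow>\<^sub>M split_law M G V A m) = (tree_space M G V A \<rightarrow>\<^sub>M count_space UNIV)"
    by (rule measurable_cong_sets) simp_all
  ultimately show ?thesis by simp
qed

lemma measurable_items: "(\<lambda>s. items D n s u) \<in> tree_space M G V A \<rightarrow>\<^sub>M count_space UNIV"
proof (induction u)
  case (Cons i u)
  let ?F = "\<lambda>o' s. case o' of None \<Rightarrow> None
    | Some m \<Rightarrow> if D \<le> m \<and> i < length (s (u, m)) then Some (s (u, m) ! i) else None"
  have "?F o' \<in> tree_space M G V A \<rightarrow>\<^sub>M count_space UNIV" for o' :: "nat option"
  proof (cases o')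
    case (Some m)
    show ?thesis
      unfolding Some option.case
      by (rule measurable_compose[OF measurable_outcome[of u m],
            of "\<lambda>x. if D \<le> m \<and> i < length x then Some (x ! i) else None"]) simp
  qed simp
  from measurable_compose_countable[OF this Cons.IH] show ?case
    by simp
qed simp

lemma borel_measurable_num_nodes: "num_nodes D n \<in> borel_measurable (tree_space M G V A)"
proof -
  interpret sigma_finite_measure "count_space (UNIV :: nat list set)"
    by (rule sigma_finite_measure_count_space_countable) simp
  have [measurable]: "(\<lambda>s. indicator (- {None}) (items D n s u) :: ennreal)
      \<in> borel_measurable (tree_space M G V A)" for u
    by (rule measurable_compose[OF measurable_items]) simp
  have "(\<lambda>z. indicator (- {None}) (items D n (fst z) (snd z)) :: ennreal)
      \<in> borel_measurable (tree_space M G V A \<Otimes>\<^sub>M count_space (UNIV :: nat list set))"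
    by (rule measurable_compose_countable[where g = snd]) measurable
  then have "(\<lambda>s. \<integral>\<^sup>+u. indicator (- {None}) (items D n s u) \<partial>count_space UNIV)
      \<in> borel_measurable (tree_space M G V A)"
    by (intro borel_measurable_nn_integral) (simp add: split_beta')
  moreover have "num_nodes D n s = (\<integral>\<^sup>+u. indicator (- {None}) (items D n s u) \<partial>count_space UNIV)" for s
    by (simp add: num_nodes_def indicator_def flip: nn_integral_indicator)
  ultimately show ?thesis by (simp cong: measurable_cong)
qed

lemma mean_nodes_eq:
  "mean_nodes M G V A D n =
    (\<integral>\<^sup>+u. \<integral>\<^sup>+s. indicator (- {None}) (items D n s u) \<partial>tree_space M G V A \<partial>count_space UNIV)"
proof -
  have [measurable]: "(\<lambda>s. indicator (- {None}) (items D n s u) :: ennreal)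
      \<in> borel_measurable (tree_space M G V A)" for u
    by (rule measurable_compose[OF measurable_items]) simp
  have "num_nodes D n s = (\<integral>\<^sup>+u. indicator (- {None}) (items D n s u) \<partial>count_space UNIV)" for s
    by (simp add: num_nodes_def indicator_def flip: nn_integral_indicator)
  then show ?thesis
    by (simp add: mean_nodes_def nn_integral_count_space_nn_integral)
qed

text \<open>The way a node is split is independent of the number of items that it receives.\<close>

lemma nn_integral_outcome_items:
  "(\<integral>\<^sup>+s. f (s (u, m)) * indicator {Some m} (items D n s u) \<partial>tree_space M G V A) =
    (\<integral>\<^sup>+x. f x \<partial>split_law M G V A m)
    * (\<integral>\<^sup>+s. indicator {Some m} (items D n s u) \<partial>tree_space M G V A)"
proof -
  have [measurable]: "(\<lambda>s. indicator {Some m} (items D n s u) :: ennreal)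
      \<in> borel_measurable (PiM UNIV (\<lambda>(u, m). split_law M G V A m))"
    unfolding tree_space_def[symmetric] by (rule measurable_compose[OF measurable_items]) simp
  have [measurable]: "f \<in> borel_measurable (split_law M G V A m)"
    by (rule borel_measurable_split_law)
  show ?thesis
    unfolding tree_space_def
    using nn_integral_PiM_indep_component[of UNIV "\<lambda>(u, m). split_law M G V A m" "(u, m)" f
        "\<lambda>s. indicator {Some m} (items D n s u)"]
    by (auto simp: prob_space_split_law items_upd_later)
qed

text \<open>
  Conditioning on the number of items at \<open>u\<close>: the number of items selects which outcome is used, and
  each outcome has its own splitting law.
\<close>

lemma nn_integral_items:
  fixes F :: "nat \<Rightarrow> nat list \<Rightarrow> ennreal"
  shows "(\<integral>\<^sup>+s. (case items D n s u of None \<Rightarrow> 0 | Some m \<Rightarrow> F m (s (u, m))) \<partial>tree_space M G V A) =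
    (\<integral>\<^sup>+m. (\<integral>\<^sup>+x. F m x \<partial>split_law M G V A m)
      * (\<integral>\<^sup>+s. indicator {Some m} (items D n s u) \<partial>tree_space M G V A) \<partial>count_space UNIV)"
proof -
  have [measurable]: "(\<lambda>s. F m (s (u, m))) \<in> borel_measurable (tree_space M G V A)" for m
    by (rule measurable_compose[OF measurable_outcome]) simp
  have [measurable]: "(\<lambda>s. indicator {Some m} (items D n s u) :: ennreal)
      \<in> borel_measurable (tree_space M G V A)" for m
    by (rule measurable_compose[OF measurable_items]) simp
  have "(case items D n s u of None \<Rightarrow> 0 | Some m \<Rightarrow> F m (s (u, m))) =
      (\<integral>\<^sup>+m. F m (s (u, m)) * indicator {Some m} (items D n s u) \<partial>count_space UNIV)" for s
  proof (cases "items D n s u")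
    case (Some k)
    then show ?thesis
      by (subst nn_integral_count_space'[of "{k}"]) auto
  qed simp
  then have "(\<integral>\<^sup>+s. (case items D n s u of None \<Rightarrow> 0 | Some m \<Rightarrow> F m (s (u, m))) \<partial>tree_space M G V A) =
      (\<integral>\<^sup>+m. \<integral>\<^sup>+s. F m (s (u, m)) * indicator {Some m} (items D n s u) \<partial>tree_space M G V A \<partial>count_space UNIV)"
    by (simp add: nn_integral_count_space_nn_integral)
  then show ?thesis
    by (simp only: nn_integral_outcome_items)
qed

text \<open>
  From one generation to the next, the mean of the sum of \<open>h\<close> decreases by at least the mean number of
  nodes of the first one: a node that is split is replaced by its children, and a leaf disappears
  together with its value \<open>h m \<ge> 1\<close>. These decreases add up to at most the initial value \<open>h n\<close>.
\<close>

lemma mean_nodes_le_supersolution: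
  fixes h :: "nat \<Rightarrow> ennreal"
  assumes drift: "\<And>m. D \<le> m \<Longrightarrow> 1 + (\<integral>\<^sup>+x. (\<Sum>y\<leftarrow>x. h y) \<partial>split_law M G V A m) \<le> h m"
    and ge_1: "\<And>m. 1 \<le> h m"
  shows "mean_nodes M G V A D n \<le> h n"
proof -
  let ?T = "tree_space M G V A"
  \<comment> \<open>\<open>p u\<close> is the probability that \<open>u\<close> is a node, \<open>q u\<close> the mean of \<open>h\<close> at \<open>u\<close>, and \<open>P u m\<close> the law
    of the number of items there. \<open>H m\<close> is the mean of \<open>h\<close> summed over the children, which is \<open>0\<close> for
    a leaf.\<close>
  define p where "p u = (\<integral>\<^sup>+s. indicator (- {None}) (items D n s u) \<partial>?T)" for u
  define q where "q u = (\<integral>\<^sup>+s. (case items D n s u of None \<Rightarrow> 0 | Some m \<Rightarrow> h m) \<partial>?T)" for u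
  define P where "P u m = (\<integral>\<^sup>+s. indicator {Some m} (items D n s u) \<partial>?T)" for u m
  define H where "H m = (if D \<le> m then \<integral>\<^sup>+x. (\<Sum>y\<leftarrow>x. h y) \<partial>split_law M G V A m else 0)" for m
  have unit: "emeasure (split_law M G V A m) (space (split_law M G V A m)) = 1" for m
    using prob_space.emeasure_space_1[OF prob_space_split_law] .
  have p: "p u = (\<integral>\<^sup>+m. P u m \<partial>count_space UNIV)" for u
  proof -
    have "p u = (\<integral>\<^sup>+s. (case items D n s u of None \<Rightarrow> 0 | Some m \<Rightarrow> 1) \<partial>?T)"
      unfolding p_def by (intro nn_integral_cong) (simp split: option.split)
    then show ?thesis
      by (simp add: nn_integral_items[where F = "\<lambda>_ _. 1"] P_def unit)
  qed
  have q: "q u = (\<integral>\<^sup>+m. h m * P u m \<partial>count_space UNIV)" for u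
    by (simp add: q_def nn_integral_items[where F = "\<lambda>m _. h m"] P_def unit)
  have children: "(\<integral>\<^sup>+i. q (i # u) \<partial>count_space UNIV) = (\<integral>\<^sup>+m. H m * P u m \<partial>count_space UNIV)" for u
  proof -
    let ?F = "\<lambda>i m x. if D \<le> m \<and> i < length x then h (x ! i) else 0"
    have meas: "?F i m \<in> borel_measurable (split_law M G V A m)" for i m
      by (rule borel_measurable_split_law)
    have sum_F: "(\<integral>\<^sup>+i. ?F i m x \<partial>count_space UNIV) = (if D \<le> m then \<Sum>y\<leftarrow>x. h y else 0)" for m x
    proof (subst nn_integral_count_space'[of "{..<length x}"])
      show "(\<Sum>i<length x. ?F i m x) = (if D \<le> m then \<Sum>y\<leftarrow>x. h y else 0)"
        by (simp add: sum_list_sum_nth atLeast0LessThan)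
    qed auto
    have H: "(\<integral>\<^sup>+x. \<integral>\<^sup>+i. ?F i m x \<partial>count_space UNIV \<partial>split_law M G V A m) = H m" for m
      by (simp only: sum_F) (simp add: H_def)
    have "q (i # u) = (\<integral>\<^sup>+s. (case items D n s u of None \<Rightarrow> 0 | Some m \<Rightarrow> ?F i m (s (u, m))) \<partial>?T)" for i
      unfolding q_def by (intro nn_integral_cong) (auto split: option.split)
    then have "q (i # u) = (\<integral>\<^sup>+m. (\<integral>\<^sup>+x. ?F i m x \<partial>split_law M G V A m) * P u m \<partial>count_space UNIV)" for i
      using nn_integral_items[where F = "?F i"] by (simp only: P_def)
    then have "(\<integral>\<^sup>+i. q (i # u) \<partial>count_space UNIV) =
        (\<integral>\<^sup>+i. \<integral>\<^sup>+m. (\<integral>\<^sup>+x. ?F i m x \<partial>split_law M G V A m) * P u m \<partial>count_space UNIV \<partial>count_space UNIV)"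
      by (simp only:)
    also have "\<dots> = (\<integral>\<^sup>+m. \<integral>\<^sup>+i. (\<integral>\<^sup>+x. ?F i m x \<partial>split_law M G V A m) * P u m \<partial>count_space UNIV \<partial>count_space UNIV)"
      by (rule nn_integral_count_space_nn_integral) auto
    also have "\<dots> = (\<integral>\<^sup>+m. (\<integral>\<^sup>+x. \<integral>\<^sup>+i. ?F i m x \<partial>count_space UNIV \<partial>split_law M G V A m) * P u m \<partial>count_space UNIV)"
      using meas by (simp add: nn_integral_multc nn_integral_count_space_nn_integral)
    also have "\<dots> = (\<integral>\<^sup>+m. H m * P u m \<partial>count_space UNIV)"
      by (simp only: H)
    finally show ?thesis .
  qed
  have step: "p u + (\<integral>\<^sup>+i. q (i # u) \<partial>count_space UNIV) \<le> q u" for u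
  proof -
    have "1 + H m \<le> h m" for m
      using drift ge_1 by (simp add: H_def)
    then have "(\<integral>\<^sup>+m. (1 + H m) * P u m \<partial>count_space UNIV) \<le> (\<integral>\<^sup>+m. h m * P u m \<partial>count_space UNIV)"
      by (intro nn_integral_mono mult_right_mono) auto
    then show ?thesis
      by (simp add: p q[of u] children distrib_right nn_integral_add)
  qed
  \<comment> \<open>Totals of \<open>p\<close> and \<open>q\<close> over generation \<open>k\<close>.\<close>
  define p' where "p' k = (\<integral>\<^sup>+u. p u * indicator {u. length u = k} u \<partial>count_space UNIV)" for k
  define q' where "q' k = (\<integral>\<^sup>+u. q u * indicator {u. length u = k} u \<partial>count_space UNIV)" for k
  have generation: "p' k + q' (Suc k) \<le> q' k" for k
  proof -
    have "q' (Suc k) = (\<integral>\<^sup>+u. (\<integral>\<^sup>+i. q (i # u) \<partial>count_space UNIV) * indicator {u. length u = k} u \<partial>count_space UNIV)"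
      unfolding q'_def
      by (subst nn_integral_count_space_lists)
        (auto simp: indicator_def intro!: nn_integral_cong)
    then have "p' k + q' (Suc k) = (\<integral>\<^sup>+u. (p u + (\<integral>\<^sup>+i. q (i # u) \<partial>count_space UNIV))
        * indicator {u. length u = k} u \<partial>count_space UNIV)"
      by (simp add: p'_def distrib_right nn_integral_add)
    also have "\<dots> \<le> q' k"
      unfolding q'_def by (intro nn_integral_mono mult_right_mono step) auto
    finally show ?thesis .
  qed
  have partial: "(\<Sum>k<j. p' k) + q' j \<le> q' 0" for j
  proof (induction j)
    case (Suc j)
    have "(\<Sum>k<Suc j. p' k) + q' (Suc j) = (\<Sum>k<j. p' k) + (p' j + q' (Suc j))"
      by (simp add: ac_simps)
    also have "\<dots> \<le> (\<Sum>k<j. p' k) + q' j"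
      by (intro add_left_mono generation)
    also note Suc.IH
    finally show ?case .
  qed simp
  have "q' 0 = q []"
    unfolding q'_def by (subst nn_integral_count_space'[of "{[]}"]) auto
  also have "\<dots> = h n"
    using prob_space.emeasure_space_1[OF prob_space_tree_space] by (simp add: q_def)
  finally have q'0: "q' 0 = h n" .
  have "mean_nodes M G V A D n = (\<integral>\<^sup>+u. p u \<partial>count_space UNIV)"
    by (simp add: mean_nodes_eq p_def)
  also have "\<dots> = (\<integral>\<^sup>+u. (\<Sum>k. p u * indicator {u. length u = k} u) \<partial>count_space UNIV)"
  proof (rule nn_integral_cong)
    fix u :: "nat list"
    have "(\<Sum>k. p u * indicator {u. length u = k} u) = (\<Sum>k\<in>{length u}. p u * indicator {u. length u = k} u)"
      by (rule suminf_finite) auto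
    then show "p u = (\<Sum>k. p u * indicator {u. length u = k} u)" by simp
  qed
  also have "\<dots> = (\<Sum>k. p' k)"
    unfolding p'_def by (rule nn_integral_suminf) simp
  also have "\<dots> \<le> h n"
  proof (rule suminf_le_const)
    show "(\<Sum>k<j. p' k) \<le> h n" for j
      using order_trans[OF _ partial[of j]] q'0 by (simp add: le_add_same_cancel1)
  qed simp
  finally show ?thesis .
qed

end

section \<open>Small arrivals\<close>

text \<open>On the integers, \<open>1/2\<close> separates \<open>0\<close> from the rest, and the limit law has no atom there.\<close>

lemma prob_pos_tendsto_0:
  fixes A :: "'b \<Rightarrow> nat pmf"
  assumes "weak_conv_along (\<lambda>\<epsilon>. distr (measure_pmf (A \<epsilon>)) borel real) (return borel 0) F"
  shows "((\<lambda>\<epsilon>. measure_pmf.prob (A \<epsilon>) {0<..}) \<longlongrightarrow> 0) F"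
proof -
  interpret R: real_distribution "return borel (0::real)"
    by (simp add: real_distribution_def real_distribution_axioms_def prob_space_return)
  have cdf_A: "cdf (distr (measure_pmf (A \<epsilon>)) borel real) (1/2) = 1 - measure_pmf.prob (A \<epsilon>) {0<..}" for \<epsilon>
  proof -
    have "real -` {..1/2} = - {0::nat<..}"
      by (auto simp: not_less)
    then show ?thesis
      using measure_pmf.prob_compl[of "{0<..}" "A \<epsilon>"]
      by (simp add: cdf_def measure_distr Compl_eq_Diff_UNIV)
  qed
  have "isCont (cdf (return borel (0::real))) (1/2)"
    by (simp add: R.isCont_cdf measure_return)
  then have "((\<lambda>\<epsilon>. cdf (distr (measure_pmf (A \<epsilon>)) borel real) (1/2)) \<longlongrightarrow> cdf (return borel 0) (1/2)) F"
    using assms unfolding weak_conv_along_def by blast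
  moreover have "cdf (return borel (0::real)) (1/2) = 1"
    by (simp add: cdf_def measure_return)
  ultimately have "((\<lambda>\<epsilon>. 1 - measure_pmf.prob (A \<epsilon>) {0<..}) \<longlongrightarrow> 1) F"
    by (simp only: cdf_A)
  from tendsto_diff[OF tendsto_const[of 1] this] show ?thesis by simp
qed

lemma expectation_eq_prob_pos_mult_mean_given_pos:
  fixes A :: "nat pmf"
  shows "measure_pmf.expectation A real = measure_pmf.prob A {0<..} * mean_given_pos A"
proof (cases "measure_pmf.prob A {0<..} = 0")
  case True
  then have "AE k in A. k \<notin> {0<..}"
    by (simp add: measure_pmf.prob_eq_0)
  then have "measure_pmf.expectation A real = measure_pmf.expectation A (\<lambda>_. 0)"
    by (intro integral_cong_AE) (auto elim: eventually_mono)
  then show ?thesis using True by simp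
next
  case False
  have "measure_pmf.expectation A (\<lambda>k. real k * indicator {0<..} k) = measure_pmf.expectation A real"
    by (intro Bochner_Integration.integral_cong) (auto simp: indicator_def)
  then show ?thesis using False by (simp add: mean_given_pos_def)
qed

lemma eventually_expectation_le:
  fixes A :: "'b \<Rightarrow> nat pmf"
  assumes conv: "weak_conv_along (\<lambda>\<epsilon>. distr (measure_pmf (A \<epsilon>)) borel real) (return borel 0) F"
    and bounded: "Limsup F (\<lambda>\<epsilon>. ereal (mean_given_pos (A \<epsilon>))) < \<infinity>"
    and "0 < r"
  shows "eventually (\<lambda>\<epsilon>. measure_pmf.expectation (A \<epsilon>) real \<le> r) F"
proof -
  obtain N :: nat where "Limsup F (\<lambda>\<epsilon>. ereal (mean_given_pos (A \<epsilon>))) < ereal (real N)"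
    using bounded less_PInf_Ex_of_nat by auto
  then have "eventually (\<lambda>\<epsilon>. mean_given_pos (A \<epsilon>) < real N + 1) F"
    by (auto dest!: Limsup_lessD elim!: eventually_mono)
  moreover have "eventually (\<lambda>\<epsilon>. measure_pmf.prob (A \<epsilon>) {0<..} < r / (real N + 1)) F"
    using \<open>0 < r\<close> by (intro order_tendstoD(2)[OF prob_pos_tendsto_0[OF conv]]) simp
  ultimately show ?thesis
  proof eventually_elim
    case (elim \<epsilon>)
    have "measure_pmf.expectation (A \<epsilon>) real \<le> measure_pmf.prob (A \<epsilon>) {0<..} * (real N + 1)"
      using elim(1) by (simp add: expectation_eq_prob_pos_mult_mean_given_pos mult_left_mono)
    also have "\<dots> \<le> r"
      using elim(2) by (simp add: field_simps)
    finally show ?case .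
  qed
qed


section \<open>Poisson transform of sequences of linear growth\<close>

lemma
  assumes r: "\<And>n. 1 \<le> n \<Longrightarrow> \<bar>r n\<bar> \<le> real n * C"
  shows summable_poisson_term: "summable (poisson_term r x)"
    and poisson_transform_differentiable: "poisson_transform r differentiable (at x)"
proof -
  define c where "c n = r n / fact n" for n
  have power_series: "summable (\<lambda>n. c n * x ^ n)" for x
  proof (rule summable_comparison_test')
    show "summable (\<lambda>n. \<bar>C\<bar> * (inverse (fact n) * (2 * \<bar>x\<bar>) ^ n))"
      by (intro summable_mult summable_exp)
    fix n :: nat assume "1 \<le> n"
    \<comment> \<open>With \<open>n \<le> 2 ^ n\<close>, the exponential series at \<open>2 * \<bar>x\<bar>\<close> is a majorant.\<close>
    have "\<bar>r n\<bar> \<le> real n * \<bar>C\<bar>"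
      using r[OF \<open>1 \<le> n\<close>] by (rule order_trans) (simp add: mult_left_mono)
    also have "\<dots> \<le> 2 ^ n * \<bar>C\<bar>"
      by (intro mult_right_mono) (auto intro: less_imp_le of_nat_less_two_power)
    finally have "\<bar>r n\<bar> * (inverse (fact n) * \<bar>x\<bar> ^ n) \<le> 2 ^ n * \<bar>C\<bar> * (inverse (fact n) * \<bar>x\<bar> ^ n)"
      by (intro mult_right_mono) auto
    then show "norm (c n * x ^ n) \<le> \<bar>C\<bar> * (inverse (fact n) * (2 * \<bar>x\<bar>) ^ n)"
      by (simp add: c_def abs_mult power_abs power_mult_distrib divide_inverse mult_ac)
  qed
  have poisson_term: "poisson_term r x = (\<lambda>n. c n * x ^ n * exp (- x))" for x
    by (auto simp: poisson_term_def c_def)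
  show "summable (poisson_term r x)"
    unfolding poisson_term by (intro summable_mult2 power_series)
  have "poisson_transform r = (\<lambda>x. (\<Sum>n. c n * x ^ n) * exp (- x))"
    by (simp add: poisson_transform_def poisson_term suminf_mult2[OF power_series] fun_eq_iff)
  moreover have "(\<lambda>x. \<Sum>n. c n * x ^ n) differentiable (at x)"
    using termdiffs_strong_converges_everywhere[OF power_series]
    by (auto simp: real_differentiable_def)
  moreover have "(\<lambda>x::real. exp (- x)) differentiable (at x)"
    unfolding real_differentiable_def by (intro exI) (auto intro!: derivative_eq_intros)
  ultimately show "poisson_transform r differentiable (at x)"
    by (simp add: differentiable_mult)
qed


section \<open>Linear growth of the mean number of nodes\<close>

theorem theorem3:
  fixes M :: "'a measure" and G :: "'a \<Rightarrow> nat" and V :: "nat \<Rightarrow> nat \<Rightarrow> 'a \<Rightarrow> real"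
    and D :: nat and A :: "real \<Rightarrow> nat pmf"
  assumes mechanism: "branching_mechanism M G V"
    and D: "2 \<le> D"
    and zero_weights:
      "(\<integral>\<^sup>+w. of_nat (card {i \<in> {1..G w}. V i (G w) w = 0}) \<partial>M) < \<infinity>"
    and support: "\<exists>\<delta>. 0 < \<delta> \<and> \<delta> < 1 \<and> measure (splitting_measure M G V) {0..\<delta>} = 1"
    and log_moment:
      "(\<integral>\<^sup>+x\<in>{0..1}. ennreal (\<bar>ln x\<bar> / x) \<partial>splitting_measure M G V) < \<infinity>"
    and A_integrable: "\<forall>\<epsilon>>0. integrable (measure_pmf (A \<epsilon>)) real"
    and A_to_0: "weak_conv_along (\<lambda>\<epsilon>. distr (measure_pmf (A \<epsilon>)) borel real) (return borel 0) (at_right 0)"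
    and A_limsup: "Limsup (at_right 0) (\<lambda>\<epsilon>. ereal (mean_given_pos (A \<epsilon>))) < \<infinity>"
  shows "\<exists>\<epsilon>\<^sub>0>0. \<exists>C::real. \<forall>\<epsilon>. 0 < \<epsilon> \<and> \<epsilon> \<le> \<epsilon>\<^sub>0 \<longrightarrow>
    (\<forall>n. integrable_nodes M G V (A \<epsilon>) D n) \<and>
    (\<forall>n\<ge>1. mean_nodes M G V (A \<epsilon>) D n \<le> ennreal (real n * C)) \<and>
    (let r = (\<lambda>n. enn2real (mean_nodes M G V (A \<epsilon>) D n)) in
       (\<forall>x. summable (poisson_term r x)) \<and>
       (\<forall>x. poisson_transform r differentiable (at x)))"
proof -
  interpret branching_mechanism M G V by (rule mechanism)
  obtain \<delta> where \<delta>: "0 < \<delta>" "\<delta> < 1" and W: "measure (splitting_measure M G V) {0..\<delta>} = 1"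
    using support by blast
  note le = AE_weights_le[OF W]
  have "(\<integral>\<^sup>+w. of_nat (G w) \<partial>M) < \<infinity>"
    by (rule nn_integral_num_children_finite[OF zero_weights le \<delta> log_moment])
  then obtain \<gamma> where \<gamma>: "(\<integral>\<^sup>+w. of_nat (G w) \<partial>M) = ennreal \<gamma>" "0 \<le> \<gamma>"
    by (auto simp: less_top_ennreal)
  \<comment> \<open>The smallest \<open>K\<close> allowed by the drift condition; it does not involve the arrivals.\<close>
  define K where "K = (1 + 2 * \<gamma>) / (1 - \<delta>)"
  have K: "0 \<le> K" "1 + 2 * \<gamma> \<le> K * (1 - \<delta>)"
    using \<gamma>(2) \<delta> by (simp_all add: K_def)
  have "eventually (\<lambda>\<epsilon>. measure_pmf.expectation (A \<epsilon>) real \<le> 1 / (K + 1)) (at_right 0)"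
    using K(1) by (intro eventually_expectation_le[OF A_to_0 A_limsup]) simp
  then obtain b where b: "0 < b"
    "\<And>\<epsilon>. 0 < \<epsilon> \<Longrightarrow> \<epsilon> < b \<Longrightarrow> measure_pmf.expectation (A \<epsilon>) real \<le> 1 / (K + 1)"
    unfolding eventually_at_right_field by blast
  have "(\<forall>n. integrable_nodes M G V (A \<epsilon>) D n) \<and>
    (\<forall>n\<ge>1. mean_nodes M G V (A \<epsilon>) D n \<le> ennreal (real n * (K + 1))) \<and>
    (let r = (\<lambda>n. enn2real (mean_nodes M G V (A \<epsilon>) D n)) in
       (\<forall>x. summable (poisson_term r x)) \<and>
       (\<forall>x. poisson_transform r differentiable (at x)))" if \<epsilon>: "0 < \<epsilon>" "\<epsilon> \<le> b / 2" for \<epsilon>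
  proof -
    define \<mu> where "\<mu> = measure_pmf.expectation (A \<epsilon>) real"
    have "\<mu> \<le> 1 / (K + 1)"
      using b \<epsilon> by (simp add: \<mu>_def)
    then have \<mu>: "(K + 1) * \<mu> \<le> 1"
      using K(1) by (simp add: field_simps)
    have "(\<integral>\<^sup>+k. of_nat k \<partial>A \<epsilon>) = ennreal \<mu>"
      using A_integrable \<epsilon> unfolding \<mu>_def ennreal_of_nat_eq_real_of_nat
      by (intro nn_integral_eq_integral) auto
    then have arrivals: "ennreal (K + 1) * (\<integral>\<^sup>+k. of_nat k \<partial>A \<epsilon>) \<le> 1"
      using \<mu> K(1) by (simp add: ennreal_le_1 flip: ennreal_mult' del: ennreal_plus)
    have bound: "mean_nodes M G V (A \<epsilon>) D n \<le> ennreal (potential K n)" for n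
    proof (rule mean_nodes_le_supersolution)
      show "1 + (\<integral>\<^sup>+x. (\<Sum>y\<leftarrow>x. ennreal (potential K y)) \<partial>split_law M G V (A \<epsilon>) m)
          \<le> ennreal (potential K m)" if "D \<le> m" for m
        using that D \<delta> by (intro potential_drift[OF le _ \<gamma> K arrivals]) auto
      show "1 \<le> ennreal (potential K m)" for m
        using potential_ge_1[OF K(1)] by simp
    qed
    have linear: "mean_nodes M G V (A \<epsilon>) D n \<le> ennreal (real n * (K + 1))" if "1 \<le> n" for n
      using that K(1) by (intro order_trans[OF bound] ennreal_leI) (simp add: potential_def mult.commute)
    have integrable: "integrable_nodes M G V (A \<epsilon>) D n" for n
      using le_less_trans[OF bound ennreal_less_top] borel_measurable_num_nodes
      by (simp add: integrable_nodes_def)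
    have growth: "\<bar>enn2real (mean_nodes M G V (A \<epsilon>) D n)\<bar> \<le> real n * (K + 1)" if "1 \<le> n" for n
      using linear[OF that] K(1) by (simp add: enn2real_leI)
    show ?thesis
      unfolding Let_def
      using integrable linear summable_poisson_term[of _ "K + 1", OF growth]
        poisson_transform_differentiable[of _ "K + 1", OF growth]
      by blast
  qed
  then show ?thesis
    using b(1) by (intro exI[of _ "b / 2"] conjI exI[of _ "K + 1"]) auto
qed

end
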